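(* Let $\mathbf{AbSS}:=(\mathsf{Seq}(\mathscr{L},\Rightarrow),\vdash_{\mathcal{R}})$ be an abstract sequent structure generated by a family $\mathcal{R}:=\{R_i\}_{i\in I}$ of $\mathbf{AbSS}$-rules and let $(P,\mathfrak{R})$ be a relation space. Let $v:\mathsf{Seq}(\mathscr{L},\Rightarrow)\to P$ and let $R_k\in\mathcal{R}$ be a non-axiomatic rule. Suppose that the following conditions are satisfied. (1) $R_i\cap R_k=\emptyset$ for all $R_i\in\mathcal{R}\setminus\{R_k\}$. (2) For every $((\Gamma_t\Rightarrow\Delta_t)_{t\in T},\Gamma\Rightarrow\Delta)\in R_k$, $(v(\Gamma_t\Rightarrow\Delta_t),v(\Gamma\Rightarrow\Delta))\in\mathfrak{R}$ for all $t\in T$. (3) If $\emptyset\vdash_{\mathcal{R}}\Gamma\Rightarrow\Delta$, then either $(\emptyset,\Gamma\Rightarrow\Delta)\in R_i$ for some axiomatic rule $R_i\in\mathcal{R}$, or there exist some non-axiomatic rule $R_i\in\mathcal{R}$ and $((\Gamma_j\Rightarrow\Delta_j)_{j\in J},\Gamma\Rightarrow\Delta)\in R_i$ such that $\emptyset\vdash_{\mathcal{R}}\Gamma_j\Rightarrow\Delta_j$ for all $j\in J$ and $(v(\Gamma_j\Rightarrow\Delta_j),v(\Gamma\Rightarrow\Delta))\notin\mathfrak{R}$ for some $j\in J$. (4) If $((\Gamma_j\Rightarrow\Delta_j)_{j\in J},\Gamma\Rightarrow\Delta)\in R_i$ for some rule $R_i\in\mathcal{R}$ such that $R_i\cap R_k=\emptyset$,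 with $(v(\Gamma_j\Rightarrow\Delta_j),v(\Gamma\Rightarrow\Delta))\notin\mathfrak{R}$ for some $j\in J$, and $\emptyset\vdash_{\mathcal{R}}\Gamma_j\Rightarrow\Delta_j$ for all $j\in J$, then $\emptyset\vdash_{\mathcal{R}\setminus\{R_k\}}\Gamma_j\Rightarrow\Delta_j$ for all $j\in J$. Then $R_k$ is $\mathbf{AbSS}$-eliminable.
   Context: Let $\mathscr{L}$ be a set and $\boldsymbol{O}(\mathscr{L})$ the class of all ordered lists of $\mathscr{L}$ (formally $\{\mathscr{L}^I: I\text{ a set}\}$), and let $\Rightarrow\,\subseteq\boldsymbol{O}(\mathscr{L})\times\boldsymbol{O}(\mathscr{L})$. A sequent is a pair $(\Gamma,\Delta)\in\,\Rightarrow$, written $\Gamma\Rightarrow\Delta$; $\mathsf{Seq}(\mathscr{L},\Rightarrow)$ is the set of all sequents. An abstract sequent structure is a pair $(\mathsf{Seq}(\mathscr{L},\Rightarrow),\vdash)$ with $\vdash\,\subseteq\mathcal{P}(\mathsf{Seq}(\mathscr{L},\Rightarrow))\times\mathsf{Seq}(\mathscr{L},\Rightarrow)$. An $\mathbf{AbSS}$-rule is a nonempty set $R$ such that either $R\subseteq\mathsf{Seq}(\mathscr{L},\Rightarrow)^J\times\mathsf{Seq}(\mathscr{L},\Rightarrow)$ for some nonempty index set $J$, or $R\subseteq\{\emptyset\}\times\mathsf{Seq}(\mathscr{L},\Rightarrow)$; in the latter case it is axiomatic, otherwise non-axiomatic. For an instance $((\Gamma_j\Rightarrow\Delta_j)_{j\in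 J},\Gamma\Rightarrow\Delta)\in R$, the $\Gamma_j\Rightarrow\Delta_j$ are its premises and $\Gamma\Rightarrow\Delta$ its conclusion. The structure $(\mathsf{Seq}(\mathscr{L},\Rightarrow),\vdash)$ is induced (generated) by a family $\mathcal{R}=\{R_i\}_{i\in I}$ of $\mathbf{AbSS}$-rules, and one writes $\vdash\,=\,\vdash_{\mathcal{R}}$, if: (i) $\emptyset\vdash\Gamma\Rightarrow\Delta$ whenever $(\emptyset,\Gamma\Rightarrow\Delta)\in R_i$ for an axiomatic rule $R_i$; (ii) $\emptyset\vdash\Gamma\Rightarrow\Delta$ implies that there exists $R_i$ such that either $R_i$ is axiomatic and $(\emptyset,\Gamma\Rightarrow\Delta)\in R_i$, or $((\Gamma_j\Rightarrow\Delta_j)_{j\in J},\Gamma\Rightarrow\Delta)\in R_i$ for some family of sequents with $\emptyset\vdash\Gamma_j\Rightarrow\Delta_j$ for all $j\in J$; (iii) for every non-axiomatic $R_i$ and $((\Gamma_j\Rightarrow\Delta_j)_{j\in J},\Gamma\Rightarrow\Delta)\in R_i$: if $\emptyset\vdash\Gamma_j\Rightarrow\Delta_j$ for each $j\in J$, then $\emptyset\vdash\Gamma\Rightarrow\Delta$. Likewise $\vdash_{\mathcal{R}\setminus\{R_k\}}$ denotes the relation of the abstract sequent structure on the same set of sequents induced by the family $\mathcal{R}\setminus\{R_k\}$. A rule $R_k\in\mathcal{R}$ is $\mathbf{AbSS}$-eliminable if, for every sequent $\Gamma\Rightarrow\Delta$, $\emptyset\vdash_{\mathcal{R}}\Gamma\Rightarrow\Delta$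 implies $\emptyset\vdash_{\mathcal{R}\setminus\{R_k\}}\Gamma\Rightarrow\Delta$. A relation space is a pair $(P,\mathfrak{R})$ with $P$ a set and $\mathfrak{R}\subseteq P\times P$. *)

theory Defs
  imports "HOL-Library.FuncSet"
begin

text \<open>
  A family \<open>(a\<^sub>j)\<close> indexed by a set \<open>J\<close> with values in \<open>A\<close>, that is, an element of
  \<open>A\<^sup>J\<close>, is a partial map with domain \<open>J\<close> and range inside \<open>A\<close>. Families with different
  index sets are thus different, and the only element of \<open>A\<^sup>J\<close> for empty \<open>J\<close> is
  \<^const>\<open>Map.empty\<close>, the empty set regarded as a function.
\<close>

definition families :: "'a set \<Rightarrow> 'j set \<Rightarrow> ('j \<rightharpoonup> 'a) set" where
  "families A J = {f. dom f = J \<and> ran f \<subseteq> A}"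

text \<open>
  The index sets of ordered lists range over all subsets of a type \<open>'x\<close>. Since the
  sequents form a set, all index sets that occur are subsets of one set, so an arbitrary
  type \<open>'x\<close> covers the class of all index sets.
\<close>

definition ordered_lists :: "'l set \<Rightarrow> ('x \<rightharpoonup> 'l) set" where
  "ordered_lists L = (\<Union>I. families L I)"

type_synonym ('x, 'l) sequent = "('x \<rightharpoonup> 'l) \<times> ('x \<rightharpoonup> 'l)"

text \<open>An instance of a rule consists of its family of premises and its conclusion.\<close>

type_synonym ('j, 'x, 'l) rule = "(('j \<rightharpoonup> ('x, 'l) sequent) \<times> ('x, 'l) sequent) set"

type_synonym ('x, 'l) entailment = "(('x, 'l) sequent set \<times> ('x, 'l) sequent) set"

text \<open>
  Throughout, \<open>S\<close> is the relation \<open>\<Rightarrow>\<close> between ordered lists; a sequent is an element of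
  it, so \<open>S\<close> is also the set of all sequents. \<open>D\<close> is the relation \<open>\<turnstile>\<close>.
\<close>

definition abstract_sequent_structure ::
  "'l set \<Rightarrow> ('x, 'l) sequent set \<Rightarrow> ('x, 'l) entailment \<Rightarrow> bool" where
  "abstract_sequent_structure L S D \<longleftrightarrow>
     S \<subseteq> ordered_lists L \<times> ordered_lists L \<and> D \<subseteq> Pow S \<times> S"

definition axiomatic_rule :: "('x, 'l) sequent set \<Rightarrow> ('j, 'x, 'l) rule \<Rightarrow> bool" where
  "axiomatic_rule S R \<longleftrightarrow> R \<noteq> {} \<and> R \<subseteq> {Map.empty} \<times> S"

definition nonaxiomatic_rule :: "('x, 'l) sequent set \<Rightarrow> ('j, 'x, 'l) rule \<Rightarrow> bool" where
  "nonaxiomatic_rule S R \<longleftrightarrow> R \<noteq> {} \<and> (\<exists>J. J \<noteq> {} \<and> R \<subseteq> families S J \<times> S)"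

definition AbSS_rule :: "('x, 'l) sequent set \<Rightarrow> ('j, 'x, 'l) rule \<Rightarrow> bool" where
  "AbSS_rule S R \<longleftrightarrow> nonaxiomatic_rule S R \<or> axiomatic_rule S R"

text \<open>
  The three closure conditions need not determine \<open>D\<close> uniquely (no least relation is
  asked for, and nothing is said about nonempty left-hand sides). Hence being induced by
  a set of rules is a predicate on \<open>D\<close>, not a function of the rules.
\<close>

definition induced_by ::
  "'l set \<Rightarrow> ('x, 'l) sequent set \<Rightarrow> ('x, 'l) entailment \<Rightarrow> ('j, 'x, 'l) rule set \<Rightarrow> bool"
where
  "induced_by L S D \<R> \<longleftrightarrow>
     abstract_sequent_structure L S D \<and>
     (\<forall>R\<in>\<R>. AbSS_rule S R) \<and>
     (\<forall>R\<in>\<R>. \<forall>s. axiomatic_rule S R \<longrightarrow> (Map.empty, s) \<in> R \<longrightarrow> ({}, s) \<in> D) \<and>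
     (\<forall>s. ({}, s) \<in> D \<longrightarrow>
        (\<exists>R\<in>\<R>. (axiomatic_rule S R \<and> (Map.empty, s) \<in> R) \<or>
                (\<exists>p. (p, s) \<in> R \<and> (\<forall>j\<in>dom p. ({}, the (p j)) \<in> D)))) \<and>
     (\<forall>R\<in>\<R>. \<forall>p s. nonaxiomatic_rule S R \<longrightarrow> (p, s) \<in> R \<longrightarrow>
        (\<forall>j\<in>dom p. ({}, the (p j)) \<in> D) \<longrightarrow> ({}, s) \<in> D)"

text \<open>
  \<open>D\<close> and \<open>D'\<close> are the relations \<open>\<turnstile>\<close> induced by \<open>\<R>\<close> and by \<open>\<R>\<close> without \<open>R\<close>; they are
  parameters because the rules need not determine them.
\<close>

definition AbSS_eliminable ::
  "'l set \<Rightarrow> ('x, 'l) sequent set \<Rightarrow> ('j, 'x, 'l) rule set \<Rightarrow>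
   ('x, 'l) entailment \<Rightarrow> ('x, 'l) entailment \<Rightarrow> ('j, 'x, 'l) rule \<Rightarrow> bool"
where
  "AbSS_eliminable L S \<R> D D' R \<longleftrightarrow>
     R \<in> \<R> \<and> induced_by L S D \<R> \<and> induced_by L S D' (\<R> - {R}) \<and>
     (\<forall>s\<in>S. ({}, s) \<in> D \<longrightarrow> ({}, s) \<in> D')"

definition relation_space :: "'p set \<Rightarrow> ('p \<times> 'p) set \<Rightarrow> bool" where
  "relation_space P r \<longleftrightarrow> r \<subseteq> P \<times> P"

end

theory Submission
  imports Defs
begin

text \<open>
  Everything happens at the last step of a derivation.
  By the third condition every derivable sequent is an axiom or the conclusion of an
  instance with derivable premises, one of which is not related to the conclusion by
  \<^term>\<open>r\<close>. By the second condition the rule to be eliminated has no such instance,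
  and being non-axiomatic it has no axioms either. So the last step uses another rule,
  which is still present after the removal. The fourth condition, applicable because by
  the first condition the other rule is disjoint from the removed one, makes the premises
  derivable without the removed rule, and the same last step then derives the conclusion.
\<close>

text \<open>
  A family over a nonempty index set differs from the empty family. This keeps the
  removed rule from coinciding with an axiomatic member of the rule set.
\<close>

lemma axiomatic_rule_not_nonaxiomatic:
  assumes "axiomatic_rule S Q"
  shows "\<not> nonaxiomatic_rule S Q"
  using assms unfolding axiomatic_rule_def nonaxiomatic_rule_def families_def by fastforce

lemma induced_by_axiom:
  assumes "induced_by L S D \<R>" "Q \<in> \<R>" "axiomatic_rule S Q" "(Map.empty, s) \<in> Q"
  shows "({}, s) \<in> D"
  using assms unfolding induced_by_def by blast

lemma induced_by_step:
  assumes "induced_by L S D \<R>" "Q \<in> \<R>" "nonaxiomatic_rule S Q" "(p, s) \<in> Q"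
    and "\<forall>j\<in>dom p. ({}, the (p j)) \<in> D"
  shows "({}, s) \<in> D"
  using assms unfolding induced_by_def by blast

theorem theorem4p11:
  fixes L :: "'l set"
    and S :: "('x, 'l) sequent set"
    and D D' :: "('x, 'l) entailment"
    and I :: "'i set"
    and R :: "'i \<Rightarrow> ('j, 'x, 'l) rule"
    and k :: 'i
    and P :: "'p set"
    and r :: "('p \<times> 'p) set"
    and v :: "('x, 'l) sequent \<Rightarrow> 'p"
  assumes "induced_by L S D (R ` I)"
    and "k \<in> I"
    and "nonaxiomatic_rule S (R k)"
    and "induced_by L S D' (R ` I - {R k})"
    and "relation_space P r"
    and "v \<in> S \<rightarrow> P"
    and "\<forall>Q \<in> R ` I - {R k}. Q \<inter> R k = {}"
    and "\<forall>p s. (p, s) \<in> R k \<longrightarrow> (\<forall>t\<in>dom p. (v (the (p t)), v s) \<in> r)"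
    and "\<forall>s. ({}, s) \<in> D \<longrightarrow>
           (\<exists>i\<in>I. axiomatic_rule S (R i) \<and> (Map.empty, s) \<in> R i) \<or>
           (\<exists>i\<in>I. nonaxiomatic_rule S (R i) \<and>
              (\<exists>p. (p, s) \<in> R i \<and> (\<forall>j\<in>dom p. ({}, the (p j)) \<in> D) \<and>
                   (\<exists>j\<in>dom p. (v (the (p j)), v s) \<notin> r)))"
    and "\<forall>i\<in>I. \<forall>p s. R i \<inter> R k = {} \<longrightarrow> (p, s) \<in> R i \<longrightarrow>
           (\<exists>j\<in>dom p. (v (the (p j)), v s) \<notin> r) \<longrightarrow>
           (\<forall>j\<in>dom p. ({}, the (p j)) \<in> D) \<longrightarrow>
           (\<forall>j\<in>dom p. ({}, the (p j)) \<in> D')"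
  shows "AbSS_eliminable L S (R ` I) D D' (R k)"
proof -
  have "({}, s) \<in> D'" if "({}, s) \<in> D" for s
  proof -
    from assms(9) that consider
        (axiom) i where "i \<in> I" "axiomatic_rule S (R i)" "(Map.empty, s) \<in> R i"
      | (step) i p where "i \<in> I" "nonaxiomatic_rule S (R i)" "(p, s) \<in> R i"
          "\<forall>j\<in>dom p. ({}, the (p j)) \<in> D" "\<exists>j\<in>dom p. (v (the (p j)), v s) \<notin> r"
      by blast
    then show ?thesis
    proof cases
      case axiom
      have "R i \<noteq> R k"
        using axiomatic_rule_not_nonaxiomatic[OF axiom(2)] assms(3) by metis
      then show ?thesis
        using induced_by_axiom[OF assms(4) _ axiom(2,3)] axiom(1) by blast
    next
      case step
      have "R i \<noteq> R k"
        using step(3,5) assms(8) by blast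
      then have other: "R i \<in> R ` I - {R k}"
        using step(1) by blast
      then have "R i \<inter> R k = {}"
        using assms(7) by blast
      then have "\<forall>j\<in>dom p. ({}, the (p j)) \<in> D'"
        using assms(10) step(1,3-5) by blast
      then show ?thesis
        by (rule induced_by_step[OF assms(4) other step(2,3)])
    qed
  qed
  then show ?thesis
    using assms(1,2,4) unfolding AbSS_eliminable_def by blast
qed

end
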